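(* Let $A$ be an abelian group, let $\kappa\ge\mu>|A|$ be uncountable cardinals, and suppose $\kappa$ is $\mu$-strongly compact. Then $\check{\mathrm{H}}^n(\lambda,\mathcal{A}_d)=0$ for every integer $n\ge1$ and every regular cardinal $\lambda\ge\kappa$.
   Context: For uncountable cardinals $\mu\le\kappa$, $\kappa$ is $\mu$-strongly compact if for every set $X$, every $\kappa$-complete filter on $X$ extends to a $\mu$-complete ultrafilter on $X$. $\mathcal{A}_d$ is the sheaf of locally constant $A$-valued functions and $\check{\mathrm{H}}^n(\lambda,\mathcal{A}_d)$ is Čech cohomology of $\lambda$ with the order topology. Equivalently (for $n>0$) it is the group of $n$-coherent $A$-valued families $\{\varphi_{\vec\alpha}:\alpha_0\to A\mid\vec\alpha\in[\lambda]^n\}$ modulo $n$-trivial ones, where: $f=^*g$ means finite difference; $\vec\alpha^i$ is $\vec\alpha$ with coordinate $i$ deleted; $n$-coherent means $\sum_{i=0}^n(-1)^i\varphi_{\vec\alpha^i}\restriction\alpha_0=^*0$ for all $\vec\alpha\in[\lambda]^{n+1}$; $n$-trivial means ($n=1$) some $\varphi:\lambda\to A$ has $\varphi\restriction\beta=^*\varphi_\beta$ for all $\beta$, or ($n>1$) some $\{\psi_{\vec\beta}:\beta_0\to A\mid\vec\beta\in[\lambda]^{n-1}\}$ has $\sum_{i=0}^{n-1}(-1)^i\psi_{\vec\alpha^i}\restriction\alpha_0=^*\varphi_{\vec\alpha}$ for all $\vec\alpha\in[\lambda]^n$. *)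

theory Defs
  imports "HOL-Analysis.Analysis" "HOL-Algebra.Elementary_Groups"
begin

unbundle cardinal_syntax

section \<open>Strong compactness\<close>

text \<open>
  A cardinal is a relation \<^term>\<open>r\<close> with \<^term>\<open>Card_order r\<close>. A filter on a set \<open>X\<close> is a
  library filter below \<^term>\<open>principal X\<close>; the library filter \<^term>\<open>bot\<close> is the improper one
  and has to be excluded by hand.
\<close>

definition complete_filter :: "'k rel \<Rightarrow> 'u filter \<Rightarrow> bool"
  where "complete_filter \<kappa> F \<longleftrightarrow>
    (\<forall>\<S>. |\<S>| <o \<kappa> \<longrightarrow> (\<forall>S\<in>\<S>. eventually (\<lambda>x. x \<in> S) F) \<longrightarrow> eventually (\<lambda>x. x \<in> \<Inter>\<S>) F)"

definition ultrafilter_on :: "'u set \<Rightarrow> 'u filter \<Rightarrow> bool"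
  where "ultrafilter_on X G \<longleftrightarrow> G \<le> principal X \<and> G \<noteq> bot \<and>
    (\<forall>S\<subseteq>X. eventually (\<lambda>x. x \<in> S) G \<or> eventually (\<lambda>x. x \<in> X - S) G)"

text \<open>
  In \<open>strongly_compact \<mu> \<kappa>\<close> (\<open>\<kappa>\<close> is \<open>\<mu>\<close>-strongly compact) the type \<^typ>\<open>'u\<close> is the universe over
  which \<open>X\<close> ranges. The library order is the reverse of inclusion: \<open>G \<le> F\<close> says that \<open>G\<close> extends \<open>F\<close>.
\<close>

definition strongly_compact :: "'u rel \<Rightarrow> 'u rel \<Rightarrow> bool"
  where "strongly_compact \<mu> \<kappa> \<longleftrightarrow>
    (\<forall>(X :: 'u set) F. F \<le> principal X \<and> F \<noteq> bot \<and> complete_filter \<kappa> F \<longrightarrow>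
      (\<exists>G. G \<le> F \<and> ultrafilter_on X G \<and> complete_filter \<mu> G))"

section \<open>The order topology\<close>

text \<open>The whole field is listed because the open rays do not cover a one-point order.\<close>

definition order_topology_of :: "'u rel \<Rightarrow> 'u topology"
  where "order_topology_of r =
    topology_generated_by (insert (Field r) (underS r ` Field r \<union> aboveS r ` Field r))"

section \<open>The sheaf of locally constant functions\<close>

text \<open>
  A section over \<open>U\<close> is represented by the total function that extends it by \<open>0\<close> outside \<open>U\<close>, so
  each section has exactly one representative and the group operations are pointwise.
\<close>

definition restrict0 :: "'x set \<Rightarrow> ('x \<Rightarrow> 'a::zero) \<Rightarrow> 'x \<Rightarrow> 'a"
  where "restrict0 U f = (\<lambda>x. if x \<in> U then f x else 0)"

definition locally_constant_sheaf :: "'x topology \<Rightarrow> 'x set \<Rightarrow> ('x \<Rightarrow> 'a::zero) set"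
  where "locally_constant_sheaf X U = {f. (\<forall>x. x \<notin> U \<longrightarrow> f x = 0) \<and>
    (\<forall>x\<in>U. \<exists>V. openin X V \<and> x \<in> V \<and> V \<subseteq> U \<and> (\<forall>y\<in>V. f y = f x))}"

section \<open>Cech cochains of an open cover\<close>

text \<open>
  In this section \<open>F\<close> is a sheaf of functions with the restriction maps \<^const>\<open>restrict0\<close>.
  An \<open>n\<close>-cochain assigns to every tuple \<open>[U\<^sub>0, \<dots>, U\<^sub>n]\<close> of members of the cover a section
  over \<open>U\<^sub>0 \<inter> \<dots> \<inter> U\<^sub>n\<close>. Tuples are ordered and may repeat entries; no alternation is imposed.
  Cochains are \<open>0\<close> on all other lists.
\<close>

definition open_cover :: "'x topology \<Rightarrow> 'x set set \<Rightarrow> bool"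
  where "open_cover X \<U> \<longleftrightarrow> (\<forall>U\<in>\<U>. openin X U) \<and> \<Union>\<U> = topspace X"

definition cover_tuples :: "nat \<Rightarrow> 'x set set \<Rightarrow> 'x set list set"
  where "cover_tuples n \<U> = {s. length s = Suc n \<and> set s \<subseteq> \<U>}"

definition cech_cochains ::
    "('x set \<Rightarrow> ('x \<Rightarrow> 'a::ab_group_add) set) \<Rightarrow> nat \<Rightarrow> 'x set set \<Rightarrow> ('x set list \<Rightarrow> 'x \<Rightarrow> 'a) set"
  where "cech_cochains F n \<U> = {c.
    (\<forall>s\<in>cover_tuples n \<U>. c s \<in> F (\<Inter>(set s))) \<and> (\<forall>s. s \<notin> cover_tuples n \<U> \<longrightarrow> c s = (\<lambda>x. 0))}"

definition delete_at :: "nat \<Rightarrow> 'b list \<Rightarrow> 'b list"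
  where "delete_at i s = take i s @ drop (Suc i) s"

text \<open>\<open>cech_diff n\<close> is the differential from \<open>n\<close>-cochains to \<open>(n+1)\<close>-cochains.\<close>

definition cech_diff ::
    "nat \<Rightarrow> 'x set set \<Rightarrow> ('x set list \<Rightarrow> 'x \<Rightarrow> 'a::ab_group_add) \<Rightarrow> 'x set list \<Rightarrow> 'x \<Rightarrow> 'a"
  where "cech_diff n \<U> c = (\<lambda>s. if s \<in> cover_tuples (Suc n) \<U>
    then restrict0 (\<Inter>(set s))
      (\<lambda>x. \<Sum>i\<le>Suc n. if even i then c (delete_at i s) x else - c (delete_at i s) x)
    else (\<lambda>x. 0))"

definition cech_cocycles ::
    "('x set \<Rightarrow> ('x \<Rightarrow> 'a::ab_group_add) set) \<Rightarrow> nat \<Rightarrow> 'x set set \<Rightarrow> ('x set list \<Rightarrow> 'x \<Rightarrow> 'a) set"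
  where "cech_cocycles F n \<U> = {c \<in> cech_cochains F n \<U>. cech_diff n \<U> c = (\<lambda>s x. 0)}"

definition cech_coboundaries ::
    "('x set \<Rightarrow> ('x \<Rightarrow> 'a::ab_group_add) set) \<Rightarrow> nat \<Rightarrow> 'x set set \<Rightarrow> ('x set list \<Rightarrow> 'x \<Rightarrow> 'a) set"
  where "cech_coboundaries F n \<U> =
    (case n of 0 \<Rightarrow> {\<lambda>s x. 0} | Suc m \<Rightarrow> cech_diff m \<U> ` cech_cochains F m \<U>)"

section \<open>Cech cohomology as a direct limit over open covers\<close>

definition refinement_map :: "'x set set \<Rightarrow> 'x set set \<Rightarrow> ('x set \<Rightarrow> 'x set) \<Rightarrow> bool"
  where "refinement_map \<W> \<U> \<rho> \<longleftrightarrow> (\<forall>W\<in>\<W>. \<rho> W \<in> \<U> \<and> W \<subseteq> \<rho> W)"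

definition cech_pullback ::
    "nat \<Rightarrow> 'x set set \<Rightarrow> ('x set \<Rightarrow> 'x set) \<Rightarrow> ('x set list \<Rightarrow> 'x \<Rightarrow> 'a::ab_group_add) \<Rightarrow>
      'x set list \<Rightarrow> 'x \<Rightarrow> 'a"
  where "cech_pullback n \<W> \<rho> c =
    (\<lambda>s. if s \<in> cover_tuples n \<W> then restrict0 (\<Inter>(set s)) (c (map \<rho> s)) else (\<lambda>x. 0))"

text \<open>
  Elements of the direct limit of the groups \<open>H\<^sup>n(\<U>, F)\<close> are represented by pairs of an open cover
  and a cocycle on it; two pairs are identified if they become cohomologous on a common
  refinement.
\<close>

definition cech_reps ::
    "'x topology \<Rightarrow> ('x set \<Rightarrow> ('x \<Rightarrow> 'a::ab_group_add) set) \<Rightarrow> nat \<Rightarrow>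
      ('x set set \<times> ('x set list \<Rightarrow> 'x \<Rightarrow> 'a)) set"
  where "cech_reps X F n = {(\<U>, c). open_cover X \<U> \<and> c \<in> cech_cocycles F n \<U>}"

definition cech_equiv ::
    "'x topology \<Rightarrow> ('x set \<Rightarrow> ('x \<Rightarrow> 'a::ab_group_add) set) \<Rightarrow> nat \<Rightarrow>
      ('x set set \<times> ('x set list \<Rightarrow> 'x \<Rightarrow> 'a)) rel"
  where "cech_equiv X F n = {((\<U>, c), (\<V>, d)).
    (\<U>, c) \<in> cech_reps X F n \<and> (\<V>, d) \<in> cech_reps X F n \<and>
    (\<exists>\<W> \<rho> \<sigma>. open_cover X \<W> \<and> refinement_map \<W> \<U> \<rho> \<and> refinement_map \<W> \<V> \<sigma> \<and>
      (\<lambda>s x. cech_pullback n \<W> \<rho> c s x - cech_pullback n \<W> \<sigma> d s x)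
        \<in> cech_coboundaries F n \<W>)}"

text \<open>
  Classes are added by pulling representatives back to a common refinement. The image under
  \<^const>\<open>cech_equiv\<close> saturates the sums obtained this way to a full class.
\<close>

definition cech_cohomology ::
    "'x topology \<Rightarrow> ('x set \<Rightarrow> ('x \<Rightarrow> 'a::ab_group_add) set) \<Rightarrow> nat \<Rightarrow>
      ('x set set \<times> ('x set list \<Rightarrow> 'x \<Rightarrow> 'a)) set monoid"
  where "cech_cohomology X F n = \<lparr>
    carrier = cech_reps X F n // cech_equiv X F n,
    mult = (\<lambda>P Q. cech_equiv X F n ``
      {(\<W>, \<lambda>s x. cech_pullback n \<W> \<rho> c s x + cech_pullback n \<W> \<sigma> d s x) | \<W> \<rho> \<sigma> \<U> c \<V> d.
        (\<U>, c) \<in> P \<and> (\<V>, d) \<in> Q \<and>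
        open_cover X \<W> \<and> refinement_map \<W> \<U> \<rho> \<and> refinement_map \<W> \<V> \<sigma>}),
    one = cech_equiv X F n `` {({topspace X}, \<lambda>s x. 0)}\<rparr>"

end

theory Submission
  imports Defs
begin

text \<open>
  Every cocycle \<open>c\<close> of positive degree on an open cover \<open>\<U>\<close> of \<open>\<lambda>\<close> is a coboundary already on \<open>\<U>\<close>.
  For each \<open>\<beta> < \<lambda>\<close> there is a locally constant choice \<open>u\<^sub>\<beta>\<close> of members of \<open>\<U>\<close> with
  \<open>x \<in> u\<^sub>\<beta>(x)\<close> for \<open>x \<le> \<beta>\<close>, and \<open>h\<^sub>\<beta>(s)(x) = c(u\<^sub>\<beta>(x), s)(x)\<close> is a cochain with
  coboundary \<open>c\<close> on \<open>[0, \<beta>]\<close>. Strong compactness extends the filter of tails of \<open>\<lambda>\<close>, which is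
  \<open>\<kappa>\<close>-complete by regularity, to a \<open>\<mu>\<close>-complete ultrafilter. Since \<open>|A| < \<mu>\<close>, the limit
  \<open>L(s)(x)\<close> of \<open>h\<^sub>\<beta>(s)(x)\<close> along it exists for each \<open>x\<close>, and its coboundary is \<open>c\<close> pointwise. It
  need not be locally constant at points of cofinality at least \<open>\<mu>\<close>, but it is constant on the
  isolated points near any given point. Extending it from the isolated points, which are dense,
  gives a locally constant cochain, and the identity with \<open>c\<close> persists by density.
\<close>

section \<open>Well-orders without a maximum\<close>

text \<open>Infinite cardinals are the intended instances. Having no maximum provides successors,
  which make closed initial segments open, and keeps the tails nonempty.\<close>

locale limit_order =
  fixes r :: "'u rel"
  assumes wo: "Well_order r"
    and no_max: "x \<in> Field r \<Longrightarrow> aboveS r x \<noteq> {}"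
begin

abbreviation lt (infix "\<sqsubset>\<^sub>r" 50) where "x \<sqsubset>\<^sub>r y \<equiv> (x, y) \<in> r \<and> x \<noteq> y"
abbreviation T where "T \<equiv> order_topology_of r"

lemma wo_rel: "wo_rel r"
  using wo by (simp add: wo_rel_def)

lemma trans: "(x, y) \<in> r \<Longrightarrow> (y, z) \<in> r \<Longrightarrow> (x, z) \<in> r"
  using wo_rel.TRANS[OF wo_rel] by (blast dest: transD)

lemma antisym: "(x, y) \<in> r \<Longrightarrow> (y, x) \<in> r \<Longrightarrow> x = y"
  using wo_rel.ANTISYM[OF wo_rel] by (blast dest: antisymD)

lemma le_less_trans: "(x, y) \<in> r \<Longrightarrow> y \<sqsubset>\<^sub>r z \<Longrightarrow> x \<sqsubset>\<^sub>r z"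
  using trans antisym by blast

lemma refl: "x \<in> Field r \<Longrightarrow> (x, x) \<in> r"
  using wo_rel.TOTALS[OF wo_rel] by blast

lemma linear: "x \<in> Field r \<Longrightarrow> y \<in> Field r \<Longrightarrow> x \<sqsubset>\<^sub>r y \<or> (y, x) \<in> r"
  using wo_rel.TOTALS[OF wo_rel] refl by blast

lemma least_exists:
  assumes "B \<subseteq> Field r" "B \<noteq> {}"
  obtains m where "m \<in> B" "\<And>b. b \<in> B \<Longrightarrow> (m, b) \<in> r"
  using wo_rel.minim_in[OF wo_rel assms] wo_rel.minim_least[OF wo_rel assms(1)] by blast

text \<open>The successor is the least point strictly above \<open>y\<close>. Through it
  \<open>under r y\<close>, and hence every interval open on the left and closed on the right,
  becomes an open set.\<close>

lemma successor_exists: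
  assumes "y \<in> Field r"
  obtains y' where "y' \<in> Field r" "underS r y' = under r y"
proof -
  obtain m where m: "m \<in> aboveS r y" "\<And>b. b \<in> aboveS r y \<Longrightarrow> (m, b) \<in> r"
    using least_exists[of "aboveS r y"] no_max[OF assms] by (auto simp: aboveS_def Field_def)
  have mF: "m \<in> Field r" using m by (auto simp: aboveS_def Field_def)
  have "z \<in> underS r m \<longleftrightarrow> z \<in> under r y" for z
  proof
    assume "z \<in> underS r m"
    then have z: "z \<sqsubset>\<^sub>r m" "z \<in> Field r" by (auto simp: underS_def Field_def)
    then have "\<not> y \<sqsubset>\<^sub>r z" using m(2)[of z] antisym by (auto simp: aboveS_def)
    then show "z \<in> under r y" using linear[of y z] assms z by (auto simp: under_def)
  next
    assume "z \<in> under r y"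
    then show "z \<in> underS r m"
      using m(1) le_less_trans[of z y m] by (auto simp: under_def underS_def aboveS_def)
  qed
  then show thesis using that mF by blast
qed

section \<open>The order topology: half-open intervals and isolated points\<close>

lemma topspace_T: "topspace T = Field r"
  by (auto simp: order_topology_of_def topology_generated_by_topspace underS_def aboveS_def Field_def)

lemma openin_underS: "x \<in> Field r \<Longrightarrow> openin T (underS r x)"
  unfolding order_topology_of_def by (rule topology_generated_by_Basis) auto

lemma openin_aboveS: "x \<in> Field r \<Longrightarrow> openin T (aboveS r x)"
  unfolding order_topology_of_def by (rule topology_generated_by_Basis) auto

lemma openin_under: "x \<in> Field r \<Longrightarrow> openin T (under r x)"
  by (metis openin_underS successor_exists)

lemma openin_interval:
  assumes "x \<sqsubset>\<^sub>r y"
  shows "openin T {z. x \<sqsubset>\<^sub>r z \<and> (z, y) \<in> r}"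
proof -
  have "{z. x \<sqsubset>\<^sub>r z \<and> (z, y) \<in> r} = aboveS r x \<inter> under r y"
    by (auto simp: aboveS_def under_def)
  moreover have "x \<in> Field r" "y \<in> Field r" using assms by (auto simp: Field_def)
  ultimately show ?thesis using openin_aboveS openin_under by auto
qed

text \<open>By induction on the generation of the topology. The lower bound \<open>\<delta>\<close>
  on \<open>\<gamma>\<close> carries the intersection case, where the second endpoint is sought
  above the first. It also excludes the least point, below which no endpoint exists.\<close>

lemma open_contains_interval:
  assumes "openin T U" "x \<in> U" "\<delta> \<sqsubset>\<^sub>r x"
  obtains \<gamma> where "(\<delta>, \<gamma>) \<in> r" "\<gamma> \<sqsubset>\<^sub>r x" "\<And>z. \<gamma> \<sqsubset>\<^sub>r z \<Longrightarrow> (z, x) \<in> r \<Longrightarrow> z \<in> U"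
proof -
  have "generate_topology_on (insert (Field r) (underS r ` Field r \<union> aboveS r ` Field r)) U"
    using assms(1) by (simp add: order_topology_of_def openin_topology_generated_by_iff)
  then have "\<forall>x\<in>U. \<forall>\<delta>. \<delta> \<sqsubset>\<^sub>r x \<longrightarrow>
    (\<exists>\<gamma>. (\<delta>, \<gamma>) \<in> r \<and> \<gamma> \<sqsubset>\<^sub>r x \<and> (\<forall>z. \<gamma> \<sqsubset>\<^sub>r z \<longrightarrow> (z, x) \<in> r \<longrightarrow> z \<in> U))"
  proof induction
    case Empty
    then show ?case by simp
  next
    case (Int a b)
    show ?case
    proof (intro ballI allI impI)
      fix x \<delta> assume x: "x \<in> a \<inter> b" "\<delta> \<sqsubset>\<^sub>r x"
      obtain \<gamma> where \<gamma>: "(\<delta>, \<gamma>) \<in> r" "\<gamma> \<sqsubset>\<^sub>r x" "\<forall>z. \<gamma> \<sqsubset>\<^sub>r z \<longrightarrow> (z, x) \<in> r \<longrightarrow> z \<in> a"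
        using Int x by blast
      obtain \<gamma>' where \<gamma>': "(\<gamma>, \<gamma>') \<in> r" "\<gamma>' \<sqsubset>\<^sub>r x" "\<forall>z. \<gamma>' \<sqsubset>\<^sub>r z \<longrightarrow> (z, x) \<in> r \<longrightarrow> z \<in> b"
        using Int x \<gamma>(2) by blast
      have "\<gamma> \<sqsubset>\<^sub>r z" if "\<gamma>' \<sqsubset>\<^sub>r z" for z using le_less_trans[OF \<gamma>'(1) that] .
      then show "\<exists>\<gamma>. (\<delta>, \<gamma>) \<in> r \<and> \<gamma> \<sqsubset>\<^sub>r x \<and> (\<forall>z. \<gamma> \<sqsubset>\<^sub>r z \<longrightarrow> (z, x) \<in> r \<longrightarrow> z \<in> a \<inter> b)"
        using \<gamma> \<gamma>' trans by blast
    qed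
  next
    case (UN K)
    show ?case
    proof (intro ballI allI impI)
      fix x \<delta> assume x: "x \<in> \<Union>K" "\<delta> \<sqsubset>\<^sub>r x"
      then obtain k where k: "k \<in> K" "x \<in> k" by blast
      then obtain \<gamma> where "(\<delta>, \<gamma>) \<in> r" "\<gamma> \<sqsubset>\<^sub>r x" "\<forall>z. \<gamma> \<sqsubset>\<^sub>r z \<longrightarrow> (z, x) \<in> r \<longrightarrow> z \<in> k"
        using UN.IH[OF k(1)] x(2) by blast
      then show "\<exists>\<gamma>. (\<delta>, \<gamma>) \<in> r \<and> \<gamma> \<sqsubset>\<^sub>r x \<and> (\<forall>z. \<gamma> \<sqsubset>\<^sub>r z \<longrightarrow> (z, x) \<in> r \<longrightarrow> z \<in> \<Union>K)"
        using k(1) by blast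
    qed
  next
    case (Basis s)
    then consider "s = Field r" | a where "s = underS r a" | a where "a \<in> Field r" "s = aboveS r a" by blast
    then show ?case
    proof cases
      case 1
      then show ?thesis using refl by (meson FieldI1)
    next
      case 2
      have "z \<in> s" if "x \<in> s" "(z, x) \<in> r" for z x
        using that 2 le_less_trans[of z x a] by (auto simp: underS_def)
      then show ?thesis by (meson FieldI1 refl)
    next
      case 3
      show ?thesis
      proof (intro ballI allI impI)
        fix x \<delta> assume x: "x \<in> s" "\<delta> \<sqsubset>\<^sub>r x"
        then have \<delta>: "\<delta> \<in> Field r" by (auto simp: Field_def)
        define \<gamma> where "\<gamma> = (if a \<sqsubset>\<^sub>r \<delta> then \<delta> else a)"
        have "(\<delta>, \<gamma>) \<in> r" "(a, \<gamma>) \<in> r" "\<gamma> \<sqsubset>\<^sub>r x"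
          using linear[OF 3(1) \<delta>] refl 3 \<delta> x by (auto simp: \<gamma>_def aboveS_def)
        moreover have "z \<in> s" if "\<gamma> \<sqsubset>\<^sub>r z" for z
          using le_less_trans[OF \<open>(a, \<gamma>) \<in> r\<close> that] 3 by (auto simp: aboveS_def)
        ultimately show "\<exists>\<gamma>. (\<delta>, \<gamma>) \<in> r \<and> \<gamma> \<sqsubset>\<^sub>r x \<and> (\<forall>z. \<gamma> \<sqsubset>\<^sub>r z \<longrightarrow> (z, x) \<in> r \<longrightarrow> z \<in> s)"
          by blast
      qed
    qed
  qed
  then show thesis using that assms by blast
qed

text \<open>The least element \<open>y\<close> of \<open>V\<close> works: an interval
  \<open>(\<gamma>, y]\<close> inside \<open>V\<close> contains no other point, and the least
  element of the whole order is isolated too. Identities between locally constant functions can thus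
  be checked at isolated points.\<close>

lemma isolated_points_dense:
  assumes "openin T V" "V \<noteq> {}"
  obtains y where "y \<in> V" "openin T {y}"
proof -
  have VF: "V \<subseteq> Field r" using openin_subset[OF assms(1)] by (simp add: topspace_T)
  obtain y where y: "y \<in> V" "\<And>b. b \<in> V \<Longrightarrow> (y, b) \<in> r"
    using least_exists VF assms(2) by metis
  show thesis
  proof (cases "\<exists>\<delta>. \<delta> \<sqsubset>\<^sub>r y")
    case True
    then obtain \<delta> where "\<delta> \<sqsubset>\<^sub>r y" by blast
    obtain \<gamma> where \<gamma>: "\<gamma> \<sqsubset>\<^sub>r y" "\<And>z. \<gamma> \<sqsubset>\<^sub>r z \<Longrightarrow> (z, y) \<in> r \<Longrightarrow> z \<in> V"
      using open_contains_interval[OF assms(1) y(1) \<open>\<delta> \<sqsubset>\<^sub>r y\<close>] by metis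
    have "{z. \<gamma> \<sqsubset>\<^sub>r z \<and> (z, y) \<in> r} = {y}"
      using \<gamma> y antisym refl VF by blast
    then show thesis using openin_interval[OF \<gamma>(1)] that y by simp
  next
    case False
    then have "under r y = {y}" using y VF refl by (auto simp: under_def)
    then show thesis using openin_under[of y] that y VF by auto
  qed
qed

text \<open>Transfinite induction on \<open>\<beta>\<close> plays the role of compactness of the initial segment up to \<open>\<beta>\<close>.\<close>

lemma locally_constant_choice:
  assumes "open_cover T \<U>" "\<beta> \<in> Field r"
  shows "\<exists>u. \<forall>x\<in>under r \<beta>. u x \<in> \<U> \<and> x \<in> u x \<and> (\<exists>V. openin T V \<and> x \<in> V \<and> (\<forall>y\<in>V. u y = u x))"
  using assms(2)
proof (induction \<beta> rule: wo_rel.well_order_induct[OF wo_rel])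
  case (1 \<beta>)
  obtain U where U: "U \<in> \<U>" "\<beta> \<in> U" "openin T U"
    using assms(1) 1(2) by (auto simp: open_cover_def topspace_T)
  show ?case
  proof (cases "\<exists>\<delta>. \<delta> \<sqsubset>\<^sub>r \<beta>")
    case False
    then have *: "under r \<beta> = {\<beta>}" using 1(2) refl by (auto simp: under_def)
    show ?thesis
      by (rule exI[of _ "\<lambda>_. U"]) (use U * in auto)
  next
    case True
    then obtain \<gamma> where \<gamma>: "\<gamma> \<sqsubset>\<^sub>r \<beta>" "\<And>z. \<gamma> \<sqsubset>\<^sub>r z \<Longrightarrow> (z, \<beta>) \<in> r \<Longrightarrow> z \<in> U"
      using open_contains_interval[OF U(3,2)] by metis
    have \<gamma>F: "\<gamma> \<in> Field r" using \<gamma> by (auto simp: Field_def)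
    obtain u where u: "\<forall>x\<in>under r \<gamma>. u x \<in> \<U> \<and> x \<in> u x \<and>
      (\<exists>V. openin T V \<and> x \<in> V \<and> (\<forall>y\<in>V. u y = u x))"
      using 1(1)[rule_format, of \<gamma>] \<gamma>(1) \<gamma>F by meson
    \<comment> \<open>One member \<open>U\<close> of the cover handles
      \<open>(\<gamma>, \<beta>]\<close>, and the induction hypothesis handles the rest. Both pieces
      are open, so gluing preserves local constancy.\<close>
    define w where "w = (\<lambda>x. if x \<in> under r \<gamma> then u x else U)"
    have w_under: "w z = u z" if "z \<in> under r \<gamma>" for z
      using that by (simp add: w_def)
    have w_above: "w z = U" if "\<gamma> \<sqsubset>\<^sub>r z" for z
    proof -
      have "z \<notin> under r \<gamma>" using le_less_trans[of z \<gamma> z] that by (auto simp: under_def)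
      then show ?thesis by (simp add: w_def)
    qed
    have "w x \<in> \<U> \<and> x \<in> w x \<and> (\<exists>V. openin T V \<and> x \<in> V \<and> (\<forall>y\<in>V. w y = w x))"
      if x: "x \<in> under r \<beta>" for x
    proof (cases "x \<in> under r \<gamma>")
      case True
      have ux: "u x \<in> \<U>" "x \<in> u x" using bspec[OF u True] by blast+
      obtain V where V: "openin T V" "x \<in> V" "\<forall>y\<in>V. u y = u x" using bspec[OF u True] by blast
      have "openin T (V \<inter> under r \<gamma>)" using V(1) openin_under[OF \<gamma>F] by (rule openin_Int)
      moreover have "\<forall>y\<in>V \<inter> under r \<gamma>. w y = w x"
        using V(3) w_under w_under[OF True] by (metis IntE)
      moreover have "x \<in> V \<inter> under r \<gamma>" using True V(2) by blast
      ultimately show ?thesis unfolding w_under[OF True] using ux by blast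
    next
      case False
      have "x \<in> Field r" using x by (auto simp: under_def Field_def)
      then have \<gamma>x: "\<gamma> \<sqsubset>\<^sub>r x" using linear[OF \<gamma>F, of x] False by (simp add: under_def)
      have x': "(x, \<beta>) \<in> r" using x by (simp add: under_def)
      define J where "J = {z. \<gamma> \<sqsubset>\<^sub>r z \<and> (z, \<beta>) \<in> r}"
      have "openin T J" "x \<in> J" "\<forall>y\<in>J. w y = w x"
        using openin_interval[OF \<gamma>(1)] \<gamma>x x' w_above w_above[OF \<gamma>x] by (simp_all add: J_def)
      moreover have "w x \<in> \<U>" "x \<in> w x" using w_above[OF \<gamma>x] U(1) \<gamma>(2)[OF \<gamma>x x'] by simp_all
      ultimately show ?thesis by blast
    qed
    then show ?thesis by blast
  qed
qed

text \<open>Supplies one step of an oscillating sequence below \<open>x\<close>. The assumption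
  fails for \<open>{x}\<close> with value \<open>L x\<close>, so \<open>x\<close> is not isolated
  and the isolated points found in \<open>(\<gamma>, x]\<close> lie strictly below it. Avoiding the
  value at the first such point yields the second.\<close>

lemma interval_nonconstant_left:
  assumes "\<forall>V a. openin T V \<longrightarrow> x \<in> V \<longrightarrow> (\<exists>y\<in>V. openin T {y} \<and> L y \<noteq> a)"
    and \<gamma>: "\<gamma> \<sqsubset>\<^sub>r x"
  obtains y y' where "\<gamma> \<sqsubset>\<^sub>r y" "y \<sqsubset>\<^sub>r y'" "y' \<sqsubset>\<^sub>r x" "L y \<noteq> L y'"
proof -
  have nonconst: "\<exists>y\<in>V. openin T {y} \<and> L y \<noteq> a" if "openin T V" "x \<in> V" for V a
    using assms(1) that by blast
  have not_iso: "\<not> openin T {x}" using nonconst[of "{x}" "L x"] by blast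
  have "x \<in> Field r" using \<gamma> by (auto simp: Field_def)
  then have x: "x \<in> {z. \<gamma> \<sqsubset>\<^sub>r z \<and> (z, x) \<in> r}" using \<gamma> refl by simp
  obtain y where y: "\<gamma> \<sqsubset>\<^sub>r y" "(y, x) \<in> r" "openin T {y}"
    using nonconst[OF openin_interval[OF \<gamma>] x, of "L x"] by blast
  obtain y' where y': "\<gamma> \<sqsubset>\<^sub>r y'" "(y', x) \<in> r" "openin T {y'}" "L y' \<noteq> L y"
    using nonconst[OF openin_interval[OF \<gamma>] x, of "L y"] by blast
  have less: "y \<sqsubset>\<^sub>r x" "y' \<sqsubset>\<^sub>r x" using y y' not_iso by auto
  have F: "y \<in> Field r" "y' \<in> Field r" using less by (auto simp: Field_def)
  show thesis
  proof (cases "y \<sqsubset>\<^sub>r y'")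
    case True
    then show thesis using that[of y y'] y(1) less(2) y'(4) by simp
  next
    case False
    then have "y' \<sqsubset>\<^sub>r y" using linear[OF F] y'(4) by auto
    then show thesis using that[of y' y] y'(1) less(1) y'(4) by simp
  qed
qed

text \<open>
  If \<open>L\<close> oscillates below \<open>x\<close>, it does so along a strictly increasing sequence. Each \<open>h \<beta>\<close> is constant
  left of the supremum of the sequence, hence past some index depending on \<open>\<beta>\<close>; countable
  completeness makes one index work for enough \<open>\<beta>\<close> to contradict the oscillation at this index.
\<close>

lemma eventual_value_locally_constant:
  assumes W: "openin T W" "x \<in> W"
    and tails: "\<And>y. y \<in> Field r \<Longrightarrow> eventually (\<lambda>\<beta>. y \<sqsubset>\<^sub>r \<beta>) G"
    and proper: "G \<noteq> bot"
    and countable: "\<And>P. (\<And>k::nat. eventually (P k) G) \<Longrightarrow> eventually (\<lambda>\<beta>. \<forall>k. P k \<beta>) G"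
    and L: "\<And>y. y \<in> W \<Longrightarrow> eventually (\<lambda>\<beta>. h \<beta> y = L y) G"
    and h: "\<And>\<beta> z. z \<in> W \<Longrightarrow> (z, \<beta>) \<in> r \<Longrightarrow> \<exists>V. openin T V \<and> z \<in> V \<and> (\<forall>y\<in>V. h \<beta> y = h \<beta> z)"
  shows "\<exists>V a. openin T V \<and> x \<in> V \<and> (\<forall>y\<in>V. openin T {y} \<longrightarrow> L y = a)"
proof (rule ccontr)
  assume "\<not> ?thesis"
  then have nonconst: "\<exists>y\<in>V. openin T {y} \<and> L y \<noteq> a" if "openin T V" "x \<in> V" for V a
    using that by blast
  have xF: "x \<in> Field r" using openin_subset[OF W(1)] W(2) by (auto simp: topspace_T)
  have "\<exists>\<delta>. \<delta> \<sqsubset>\<^sub>r x"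
  proof (rule ccontr)
    assume "\<not> ?thesis"
    then have "under r x = {x}" using xF refl by (auto simp: under_def)
    then show False using nonconst[of "{x}" "L x"] openin_under[OF xF] by auto
  qed
  then obtain \<delta> where \<delta>: "\<delta> \<sqsubset>\<^sub>r x" "\<And>z. \<delta> \<sqsubset>\<^sub>r z \<Longrightarrow> (z, x) \<in> r \<Longrightarrow> z \<in> W"
    using open_contains_interval[OF W] by metis
  \<comment> \<open>\<open>f\<close> climbs below \<open>x\<close>, and each gap contains a point,
    later \<open>g n\<close>, whose value differs from that at the right end of the gap. The bound
    \<open>\<delta>\<close> keeps the compared points in \<open>W\<close>.\<close>
  have "\<exists>f. \<forall>n. ((\<delta>, f n) \<in> r \<and> f n \<sqsubset>\<^sub>r x) \<and> (\<exists>y. f n \<sqsubset>\<^sub>r y \<and> y \<sqsubset>\<^sub>r f (Suc n) \<and> L y \<noteq> L (f (Suc n)))"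
  proof (rule dependent_nat_choice)
    have "(\<delta>, \<delta>) \<in> r" using \<delta>(1) refl by (auto simp: Field_def)
    then show "\<exists>\<gamma>. (\<delta>, \<gamma>) \<in> r \<and> \<gamma> \<sqsubset>\<^sub>r x" using \<delta>(1) by blast
  next
    fix \<gamma> and n :: nat
    assume \<gamma>: "(\<delta>, \<gamma>) \<in> r \<and> \<gamma> \<sqsubset>\<^sub>r x"
    then obtain y y' where y: "\<gamma> \<sqsubset>\<^sub>r y" "y \<sqsubset>\<^sub>r y'" "y' \<sqsubset>\<^sub>r x" "L y \<noteq> L y'"
      using interval_nonconstant_left[of x L \<gamma>] nonconst by metis
    have "(\<delta>, y') \<in> r" using \<gamma> y trans by blast
    then show "\<exists>\<gamma>'. ((\<delta>, \<gamma>') \<in> r \<and> \<gamma>' \<sqsubset>\<^sub>r x) \<and> (\<exists>y. \<gamma> \<sqsubset>\<^sub>r y \<and> y \<sqsubset>\<^sub>r \<gamma>' \<and> L y \<noteq> L \<gamma>')"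
      using y by blast
  qed
  then obtain f g where f: "\<And>n. (\<delta>, f n) \<in> r" "\<And>n. f n \<sqsubset>\<^sub>r x"
    and g: "\<And>n. f n \<sqsubset>\<^sub>r g n" "\<And>n. g n \<sqsubset>\<^sub>r f (Suc n)" "\<And>n. L (g n) \<noteq> L (f (Suc n))"
    by metis
  have f_Suc: "f n \<sqsubset>\<^sub>r f (Suc n)" for n using g(1,2)[of n] le_less_trans by blast
  \<comment> \<open>The supremum \<open>z\<close> of the sequence may be smaller than
    \<open>x\<close>, but it still lies in \<open>W\<close>, so \<open>h \<beta>\<close> is locally
    constant at \<open>z\<close> for every \<open>\<beta>\<close> beyond \<open>z\<close>.\<close>
  define ub where "ub = {z. \<forall>n. (f n, z) \<in> r}"
  have ub: "ub \<subseteq> Field r" "x \<in> ub" using f(2) by (auto simp: ub_def Field_def)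
  obtain z where "z \<in> ub" "\<And>w. w \<in> ub \<Longrightarrow> (z, w) \<in> r"
    using least_exists[OF ub(1)] ub(2) by blast
  then have z: "\<And>n. (f n, z) \<in> r" "\<And>w. (\<And>n. (f n, w) \<in> r) \<Longrightarrow> (z, w) \<in> r"
    by (auto simp: ub_def)
  have zx: "(z, x) \<in> r" using z(2) f(2) by blast
  have fz: "f n \<sqsubset>\<^sub>r z" for n using f_Suc[of n] z(1)[of "Suc n"] trans antisym by metis
  have zF: "z \<in> Field r" using zx by (auto simp: Field_def)
  have zW: "z \<in> W" using \<delta>(2) le_less_trans[OF f(1) fz] zx by blast
  have gz: "(g n, z) \<in> r" for n using g(2) z(1) trans by blast
  \<comment> \<open>The term \<open>f 0\<close> may be \<open>\<delta>\<close> itself, which need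
    not lie in \<open>W\<close>; only later terms are compared.\<close>
  have fW: "f (Suc n) \<in> W" for n
    by (rule \<delta>(2)[OF le_less_trans[OF f(1) f_Suc[of n]] conjunct1[OF f(2)]])
  have gW: "g n \<in> W" for n
    by (rule \<delta>(2)[OF le_less_trans[OF f(1) g(1)[of n]] trans[OF gz zx]])
  have "\<exists>k. h \<beta> (g k) = h \<beta> (f (Suc k))" if z\<beta>: "z \<sqsubset>\<^sub>r \<beta>" for \<beta>
  proof -
    obtain V where V: "openin T V" "z \<in> V" "\<forall>y\<in>V. h \<beta> y = h \<beta> z"
      using h[OF zW conjunct1[OF z\<beta>]] by blast
    obtain \<zeta> where \<zeta>: "\<zeta> \<sqsubset>\<^sub>r z" "\<And>y. \<zeta> \<sqsubset>\<^sub>r y \<Longrightarrow> (y, z) \<in> r \<Longrightarrow> y \<in> V"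
      by (rule open_contains_interval[OF V(1,2) fz[of 0]]) blast
    have "(z, \<zeta>) \<notin> r" using \<zeta>(1) antisym[of z \<zeta>] by blast
    then obtain k where k: "(f k, \<zeta>) \<notin> r" using z(2)[of \<zeta>] by blast
    have "\<zeta> \<in> Field r" "f k \<in> Field r" using \<zeta>(1) f(2)[of k] by (auto simp: Field_def)
    then have \<zeta>f: "(\<zeta>, f k) \<in> r" using linear[of "f k" \<zeta>] k by blast
    have "g k \<in> V" by (rule \<zeta>(2)[OF le_less_trans[OF \<zeta>f g(1)] gz])
    moreover have "f (Suc k) \<in> V" by (rule \<zeta>(2)[OF le_less_trans[OF \<zeta>f f_Suc] z(1)])
    ultimately
    show ?thesis using V(3) by (intro exI[of _ k]) simp
  qed
  then have "eventually (\<lambda>\<beta>. \<exists>k. h \<beta> (g k) = h \<beta> (f (Suc k))) G"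
    using tails[OF zF] by (auto elim: eventually_mono)
  \<comment> \<open>Each inequality holds eventually because the limits \<open>L\<close> differ;
    countable completeness makes all of them hold for the same \<open>\<beta>\<close>.\<close>
  moreover have "eventually (\<lambda>\<beta>. \<forall>k. h \<beta> (g k) \<noteq> h \<beta> (f (Suc k))) G"
  proof (rule countable)
    show "eventually (\<lambda>\<beta>. h \<beta> (g k) \<noteq> h \<beta> (f (Suc k))) G" for k
      using L[OF gW[of k]] L[OF fW[of k]] by eventually_elim (use g(3)[of k] in simp)
  qed
  ultimately have "eventually (\<lambda>_. False) G" by eventually_elim simp
  then show False using proper by (simp add: eventually_False)
qed

end

section \<open>Cocycles are coboundaries\<close>

lemma length_delete_at: "i < length s \<Longrightarrow> length (delete_at i s) = length s - 1"
  by (auto simp: delete_at_def)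

lemma set_delete_at: "set (delete_at i s) \<subseteq> set s"
  by (auto simp: delete_at_def dest: in_set_takeD in_set_dropD)

lemma delete_at_Cons: "delete_at 0 (u # s) = s" "delete_at (Suc i) (u # s) = u # delete_at i s"
  by (auto simp: delete_at_def)

lemma map_delete_at: "map f (delete_at i s) = delete_at i (map f s)"
  by (simp add: delete_at_def take_map drop_map)

lemma delete_at_cover_tuples:
  "s \<in> cover_tuples (Suc m) \<U> \<Longrightarrow> i \<le> Suc m \<Longrightarrow> delete_at i s \<in> cover_tuples m \<U>"
  using set_delete_at[of i s] by (auto simp: cover_tuples_def length_delete_at)

lemma Inter_delete_at: "x \<in> \<Inter>(set s) \<Longrightarrow> x \<in> \<Inter>(set (delete_at i s))"
  using set_delete_at[of i s] by blast

text \<open>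
  Prepending a member of the cover that contains the point is a contracting homotopy of the
  stalk complex.
\<close>

lemma cocycle_prepend:
  assumes c: "c \<in> cech_cocycles F (Suc m) \<U>" and s: "s \<in> cover_tuples (Suc m) \<U>"
    and x: "x \<in> \<Inter>(set s)" "x \<in> U" "U \<in> \<U>"
  shows "(\<Sum>i\<le>Suc m. if even i then c (U # delete_at i s) x else - c (U # delete_at i s) x) = c s x"
proof -
  have Us: "U # s \<in> cover_tuples (Suc (Suc m)) \<U>"
    using s x by (auto simp: cover_tuples_def)
  have "cech_diff (Suc m) \<U> c (U # s) x = 0"
    using c by (simp add: cech_cocycles_def)
  then have "0 = (\<Sum>i\<le>Suc (Suc m). if even i then c (delete_at i (U # s)) x else - c (delete_at i (U # s)) x)"
    using Us x by (simp add: cech_diff_def restrict0_def del: sum.atMost_Suc)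
  also have "\<dots> = c s x + (\<Sum>i\<le>Suc m. if odd i then c (U # delete_at i s) x else - c (U # delete_at i s) x)"
    unfolding sum.atMost_Suc_shift[of _ "Suc m"] delete_at_Cons by simp
  also have "(\<Sum>i\<le>Suc m. if odd i then c (U # delete_at i s) x else - c (U # delete_at i s) x) =
      - (\<Sum>i\<le>Suc m. if even i then c (U # delete_at i s) x else - c (U # delete_at i s) x)"
    unfolding sum_negf[symmetric] by (rule sum.cong) auto
  finally have "c s x = (\<Sum>i\<le>Suc m. if even i then c (U # delete_at i s) x else - c (U # delete_at i s) x)"
    by (simp del: sum.atMost_Suc)
  then show ?thesis by (rule sym)
qed

lemma openin_Inter_tuple:
  assumes "open_cover X \<U>" "s \<in> cover_tuples m \<U>"
  shows "openin X (\<Inter>(set s))"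
proof -
  \<comment> \<open>Tuples have positive length, so the intersection of the empty family, which is
    \<open>UNIV\<close>, does not occur.\<close>
  have "set s \<noteq> {}" using assms(2) by (cases s) (auto simp: cover_tuples_def)
  then show ?thesis
    using assms by (intro openin_Inter) (auto simp: open_cover_def cover_tuples_def)
qed

context limit_order
begin

text \<open>The four hypotheses on \<open>G\<close> are what strong compactness contributes. Degree
  \<open>Suc m\<close> leaves room for prepending: fixing the first entry of \<open>c\<close> gives
  a function of \<open>m\<close>-tuples.\<close>

lemma cocycle_is_coboundary:
  assumes cover: "open_cover T \<U>"
    and c: "c \<in> cech_cocycles (locally_constant_sheaf T :: 'u set \<Rightarrow> ('u \<Rightarrow> 'a::ab_group_add) set) (Suc m) \<U>"
    and tails: "\<And>y. y \<in> Field r \<Longrightarrow> eventually (\<lambda>\<beta>. y \<sqsubset>\<^sub>r \<beta>) G"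
    and proper: "G \<noteq> bot"
    and countable: "\<And>P. (\<And>k::nat. eventually (P k) G) \<Longrightarrow> eventually (\<lambda>\<beta>. \<forall>k. P k \<beta>) G"
    and limits: "\<And>f :: 'u \<Rightarrow> 'a. \<exists>a. eventually (\<lambda>\<beta>. f \<beta> = a) G"
  shows "c \<in> cech_coboundaries (locally_constant_sheaf T) (Suc m) \<U>"
proof -
  have "\<forall>\<beta>\<in>Field r. \<exists>u. \<forall>x\<in>under r \<beta>. u x \<in> \<U> \<and> x \<in> u x \<and>
      (\<exists>V. openin T V \<and> x \<in> V \<and> (\<forall>y\<in>V. u y = u x))"
    using locally_constant_choice[OF cover] by blast
  from bchoice[OF this] obtain u where u_all: "\<forall>\<beta>\<in>Field r. \<forall>x\<in>under r \<beta>. u \<beta> x \<in> \<U> \<and> x \<in> u \<beta> x \<and>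
      (\<exists>V. openin T V \<and> x \<in> V \<and> (\<forall>y\<in>V. u \<beta> y = u \<beta> x))" by blast
  have u: "u \<beta> x \<in> \<U>" "x \<in> u \<beta> x" "\<exists>V. openin T V \<and> x \<in> V \<and> (\<forall>y\<in>V. u \<beta> y = u \<beta> x)"
    if "(x, \<beta>) \<in> r" for x \<beta>
  proof -
    have "\<beta> \<in> Field r" "x \<in> under r \<beta>" using that by (auto simp: Field_def under_def)
    then show "u \<beta> x \<in> \<U>" "x \<in> u \<beta> x" "\<exists>V. openin T V \<and> x \<in> V \<and> (\<forall>y\<in>V. u \<beta> y = u \<beta> x)"
      using u_all by blast+
  qed
  have c_loc: "\<exists>V. openin T V \<and> x \<in> V \<and> (\<forall>y\<in>V. c s y = c s x)"
    if "s \<in> cover_tuples (Suc m) \<U>" "x \<in> \<Inter>(set s)" for s x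
    using c that unfolding cech_cocycles_def cech_cochains_def locally_constant_sheaf_def by blast
  \<comment> \<open>For fixed \<open>\<beta>\<close> this is the prepending homotopy along
    \<open>u \<beta>\<close>. Near a point up to \<open>\<beta>\<close> the first entry is fixed, so
    \<open>h\<close> inherits local constancy from \<open>c\<close>.\<close>
  define h where "h = (\<lambda>s \<beta> y. c (u \<beta> y # s) y)"
  define L where "L = (\<lambda>s y. SOME a. eventually (\<lambda>\<beta>. h s \<beta> y = a) G)"
  have L: "eventually (\<lambda>\<beta>. h s \<beta> y = L s y) G" for s y
    unfolding L_def by (rule someI_ex[OF limits])
  \<comment> \<open>Only isolated points are tested, since \<open>L\<close> is not controlled at the
    others.\<close>
  define stable where "stable = (\<lambda>s V a. \<forall>y\<in>V. openin T {y} \<longrightarrow> L s y = a)"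
  have stable_exists: "\<exists>V a. openin T V \<and> x \<in> V \<and> stable s V a"
    if s: "s \<in> cover_tuples m \<U>" and x: "x \<in> \<Inter>(set s)" for s x
    unfolding stable_def
  proof (rule eventual_value_locally_constant[OF openin_Inter_tuple[OF cover s] x tails proper countable L])
    fix \<beta> z assume z: "z \<in> \<Inter>(set s)" "(z, \<beta>) \<in> r"
    obtain V where V: "openin T V" "z \<in> V" "\<forall>y\<in>V. u \<beta> y = u \<beta> z" using u(3)[OF z(2)] by blast
    have "u \<beta> z # s \<in> cover_tuples (Suc m) \<U>"
      using s u(1)[OF z(2)] by (auto simp: cover_tuples_def)
    moreover have "z \<in> \<Inter>(set (u \<beta> z # s))" using z u(2) by auto
    ultimately obtain V' where V': "openin T V'" "z \<in> V'" "\<forall>y\<in>V'. c (u \<beta> z # s) y = c (u \<beta> z # s) z"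
      using c_loc by blast
    have "\<forall>y\<in>V \<inter> V'. h s \<beta> y = h s \<beta> z" using V(3) V'(3) by (simp add: h_def)
    then show "\<exists>V. openin T V \<and> z \<in> V \<and> (\<forall>y\<in>V. h s \<beta> y = h s \<beta> z)"
      using V V' openin_Int by blast
  qed
  define val where "val = (\<lambda>s x. SOME a. \<exists>V. openin T V \<and> x \<in> V \<and> stable s V a)"
  \<comment> \<open>The choice in \<open>val\<close> is unambiguous: two neighbourhoods of
    \<open>x\<close> meet in a nonempty open set, and an isolated point there compares their stable
    values.\<close>
  have val_eq: "val s x = a" if V: "openin T V" "x \<in> V" "stable s V a" for s x V a
  proof -
    have "\<exists>a V. openin T V \<and> x \<in> V \<and> stable s V a" using V by blast
    from someI_ex[OF this] obtain V' where V': "openin T V'" "x \<in> V'" "stable s V' (val s x)"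
      unfolding val_def by blast
    have "openin T (V \<inter> V')" "V \<inter> V' \<noteq> {}" using V V' by auto
    then obtain y where "y \<in> V \<inter> V'" "openin T {y}" by (rule isolated_points_dense)
    then show ?thesis using V(3) V'(3) unfolding stable_def by auto
  qed
  define b where "b = (\<lambda>s. if s \<in> cover_tuples m \<U> then restrict0 (\<Inter>(set s)) (val s) else (\<lambda>x. 0))"
  have "b \<in> cech_cochains (locally_constant_sheaf T) m \<U>"
  proof -
    have "b s \<in> locally_constant_sheaf T (\<Inter>(set s))" if s: "s \<in> cover_tuples m \<U>" for s
    proof -
      have "\<exists>V. openin T V \<and> x \<in> V \<and> V \<subseteq> \<Inter>(set s) \<and> (\<forall>y\<in>V. b s y = b s x)"
        if x: "x \<in> \<Inter>(set s)" for x
      proof -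
        obtain V a where V: "openin T V" "x \<in> V" "stable s V a" using stable_exists[OF s x] by blast
        \<comment> \<open>The same \<open>V\<close> witnesses the value \<open>a\<close> at each of
          its points, so \<open>val s\<close> is constant on \<open>V\<close>.\<close>
        have "\<forall>y\<in>V \<inter> \<Inter>(set s). b s y = a"
          using val_eq[OF V(1) _ V(3)] s by (simp add: b_def restrict0_def)
        then show ?thesis
          using V x openin_Int[OF V(1) openin_Inter_tuple[OF cover s]]
          by (intro exI[of _ "V \<inter> \<Inter>(set s)"]) auto
      qed
      moreover have "b s x = 0" if "x \<notin> \<Inter>(set s)" for x
        using that by (auto simp: b_def restrict0_def)
      ultimately show ?thesis unfolding locally_constant_sheaf_def by blast
    qed
    then show ?thesis by (simp add: cech_cochains_def b_def)
  qed
  moreover have "c = cech_diff m \<U> b"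
  proof (intro ext)
    fix s x
    show "c s x = cech_diff m \<U> b s x"
    proof (cases "s \<in> cover_tuples (Suc m) \<U> \<and> x \<in> \<Inter>(set s)")
      case False
      have "c s x = 0"
      proof (cases "s \<in> cover_tuples (Suc m) \<U>")
        case True
        then have "c s \<in> locally_constant_sheaf T (\<Inter>(set s))" "x \<notin> \<Inter>(set s)"
          using c False unfolding cech_cocycles_def cech_cochains_def by blast+
        then show ?thesis unfolding locally_constant_sheaf_def by blast
      next
        case outside: False
        then show ?thesis using c by (simp add: cech_cocycles_def cech_cochains_def)
      qed
      then show ?thesis using False by (auto simp: cech_diff_def restrict0_def)
    next
      case True
      then have s: "s \<in> cover_tuples (Suc m) \<U>" and x: "x \<in> \<Inter>(set s)" by blast+
      have "\<exists>V. openin T V \<and> x \<in> V \<and> stable (delete_at i s) V (val (delete_at i s) x)"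
        if "i \<le> Suc m" for i
        using stable_exists[OF delete_at_cover_tuples[OF s that] Inter_delete_at[OF x]] val_eq by metis
      then obtain V where V: "\<And>i. i \<le> Suc m \<Longrightarrow> openin T (V i)" "\<And>i. i \<le> Suc m \<Longrightarrow> x \<in> V i"
        "\<And>i. i \<le> Suc m \<Longrightarrow> stable (delete_at i s) (V i) (val (delete_at i s) x)"
        by metis
      obtain V' where V': "openin T V'" "x \<in> V'" "\<forall>y\<in>V'. c s y = c s x" using c_loc[OF s x] by blast
      \<comment> \<open>A tuple has finitely many faces, so their stable neighbourhoods meet in an
        open set. At an isolated point \<open>y\<close> of it, each \<open>val\<close> at
        \<open>x\<close> is read off from \<open>L\<close> at \<open>y\<close>, and
        \<open>c s\<close> has the same value at both points.\<close>
      define N where "N = (\<Inter>i\<le>Suc m. V i) \<inter> (V' \<inter> \<Inter>(set s))"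
      have "openin T (\<Inter>i\<le>Suc m. V i)" using V(1) by (intro openin_Inter) auto
      then have "openin T N" "x \<in> N"
        using V(2) V' x openin_Inter_tuple[OF cover s] by (auto simp: N_def)
      then obtain y where y: "y \<in> N" "openin T {y}" using isolated_points_dense by blast
      have yF: "y \<in> Field r" using openin_subset[OF y(2)] by (simp add: topspace_T)
      have ys: "y \<in> \<Inter>(set s)" using y(1) by (auto simp: N_def)
      have Ly: "L (delete_at i s) y = val (delete_at i s) x" if "i \<le> Suc m" for i
        using V(3)[OF that] y that unfolding stable_def N_def by blast
      \<comment> \<open>One \<open>\<beta>\<close> beyond \<open>y\<close> attains the limits for
        all faces at once, so the prepending identity for \<open>u \<beta> y\<close> applies at
        \<open>y\<close>.\<close>
      have "eventually (\<lambda>\<beta>. \<forall>i\<in>{..Suc m}. h (delete_at i s) \<beta> y = L (delete_at i s) y) G"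
        by (rule eventually_ball_finite) (auto intro: L)
      then have "eventually (\<lambda>\<beta>. y \<sqsubset>\<^sub>r \<beta> \<and> (\<forall>i\<in>{..Suc m}. h (delete_at i s) \<beta> y = L (delete_at i s) y)) G"
        using tails[OF yF] by (rule eventually_conj[rotated])
      then obtain \<beta> where \<beta>: "y \<sqsubset>\<^sub>r \<beta>" "\<forall>i\<in>{..Suc m}. h (delete_at i s) \<beta> y = L (delete_at i s) y"
        using eventually_happens' [OF proper] by blast
      have "c s x = c s y" using V'(3) y(1) by (simp add: N_def)
      also have "\<dots> = (\<Sum>i\<le>Suc m. if even i then h (delete_at i s) \<beta> y else - h (delete_at i s) \<beta> y)"
        unfolding h_def
        by (rule cocycle_prepend[OF c s ys u(2,1)[OF conjunct1[OF \<beta>(1)]], symmetric])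
      also have "\<dots> = (\<Sum>i\<le>Suc m. if even i then b (delete_at i s) x else - b (delete_at i s) x)"
      proof (rule sum.cong)
        fix i assume i: "i \<in> {..Suc m}"
        then have "b (delete_at i s) x = val (delete_at i s) x"
          using delete_at_cover_tuples[OF s, of i] Inter_delete_at[OF x, of i]
          by (simp add: b_def restrict0_def)
        then have "h (delete_at i s) \<beta> y = b (delete_at i s) x" using \<beta>(2) Ly i by simp
        then show "(if even i then h (delete_at i s) \<beta> y else - h (delete_at i s) \<beta> y) =
          (if even i then b (delete_at i s) x else - b (delete_at i s) x)" by simp
      qed simp
      finally show ?thesis using s x by (simp add: cech_diff_def restrict0_def del: sum.atMost_Suc)
    qed
  qed
  ultimately show ?thesis by (auto simp: cech_coboundaries_def)
qed

end

section \<open>Ultrafilters extending the tails\<close>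

text \<open>Completeness concerns families of sets; the family of the sets \<open>{x. P i x}\<close>
  has at most as many members as there are indices.\<close>

lemma complete_filter_all:
  assumes "complete_filter \<mu> G" "|UNIV :: 'i set| <o \<mu>" "\<And>i::'i. eventually (P i) G"
  shows "eventually (\<lambda>x. \<forall>i. P i x) G"
proof -
  have "|range (\<lambda>i. {x. P i x})| <o \<mu>"
    using card_of_image assms(2) by (rule ordLeq_ordLess_trans)
  then have "eventually (\<lambda>x. x \<in> \<Inter>(range (\<lambda>i. {x. P i x}))) G"
    using assms(1,3) by (auto simp: complete_filter_def)
  then show ?thesis by simp
qed

text \<open>If no fibre of \<open>f\<close> were in \<open>G\<close>, the complements of the fibres,
  fewer than \<open>\<mu>\<close> in number, would all be in \<open>G\<close>, and so would their
  empty intersection.\<close>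

lemma complete_ultrafilter_limit:
  fixes f :: "'u \<Rightarrow> 'a"
  assumes G: "ultrafilter_on X G" "complete_filter \<mu> G" and card: "|UNIV :: 'a set| <o \<mu>"
  shows "\<exists>a. eventually (\<lambda>\<beta>. f \<beta> = a) G"
proof (rule ccontr)
  assume none: "\<not> ?thesis"
  have "eventually (\<lambda>\<beta>. f \<beta> \<noteq> a) G" for a
  proof -
    \<comment> \<open>Fibres are cut down to \<open>X\<close> because the ultrafilter decides only
      subsets of \<open>X\<close>.\<close>
    have "\<not> eventually (\<lambda>\<beta>. \<beta> \<in> {\<beta> \<in> X. f \<beta> = a}) G"
    proof
      assume "eventually (\<lambda>\<beta>. \<beta> \<in> {\<beta> \<in> X. f \<beta> = a}) G"
      then have "eventually (\<lambda>\<beta>. f \<beta> = a) G" by (rule eventually_mono) simp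
      then show False using none by blast
    qed
    moreover have "{\<beta> \<in> X. f \<beta> = a} \<subseteq> X" by blast
    ultimately have "eventually (\<lambda>\<beta>. \<beta> \<in> X - {\<beta> \<in> X. f \<beta> = a}) G"
      using G(1) unfolding ultrafilter_on_def by blast
    then show ?thesis by (rule eventually_mono) auto
  qed
  then have "eventually (\<lambda>\<beta>. \<forall>a. f \<beta> \<noteq> a) G" by (rule complete_filter_all[OF G(2) card])
  then show False using G(1) by (auto simp: ultrafilter_on_def eventually_False)
qed

text \<open>On a nonempty limit order this is the filter of sets with bounded complement in the
  field.\<close>

definition tail_filter :: "'u rel \<Rightarrow> 'u filter"
  where "tail_filter r = (INF \<gamma>\<in>Field r. principal (aboveS r \<gamma>))"

context limit_order
begin

text \<open>Tails are nested and so form a filter base. Over an empty field the infimum would be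
  \<open>top\<close> and there would be no base element.\<close>

lemma eventually_tail_filter:
  assumes "Field r \<noteq> {}"
  shows "eventually P (tail_filter r) \<longleftrightarrow> (\<exists>\<gamma>\<in>Field r. \<forall>\<beta>\<in>aboveS r \<gamma>. P \<beta>)"
proof -
  have "\<exists>x\<in>Field r. principal (aboveS r x) \<le> inf (principal (aboveS r a)) (principal (aboveS r b))"
    if ab: "a \<in> Field r" "b \<in> Field r" for a b
  proof -
    have mono: "aboveS r y \<subseteq> aboveS r x" if "(x, y) \<in> r" for x y
      using le_less_trans[OF that] by (auto simp: aboveS_def)
    consider "(a, b) \<in> r" | "(b, a) \<in> r" using linear[OF ab] by blast
    then show ?thesis
      using mono[of a b] mono[of b a] ab by cases auto
  qed
  then show ?thesis
    unfolding tail_filter_def using assms by (subst eventually_INF_base) (auto simp: eventually_principal)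
qed

text \<open>Each set contains a tail. Fewer than \<open>\<kappa>\<close> starting points of tails
  are not cofinal in a regular cardinal of size at least \<open>\<kappa>\<close>, so a single tail
  lies in all the sets.\<close>

lemma tail_filter_complete:
  assumes "Card_order r" "regularCard r" "\<kappa> \<le>o r" "Field r \<noteq> {}"
  shows "complete_filter \<kappa> (tail_filter r)"
  unfolding complete_filter_def
proof (intro allI impI)
  fix \<S> :: "'u set set"
  assume card: "|\<S>| <o \<kappa>" and ev: "\<forall>S\<in>\<S>. eventually (\<lambda>x. x \<in> S) (tail_filter r)"
  have "\<forall>S\<in>\<S>. \<exists>\<gamma>. \<gamma> \<in> Field r \<and> (\<forall>\<beta>\<in>aboveS r \<gamma>. \<beta> \<in> S)"
    using ev unfolding eventually_tail_filter[OF assms(4)] by blast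
  then obtain g where g: "\<And>S. S \<in> \<S> \<Longrightarrow> g S \<in> Field r"
    "\<And>S. S \<in> \<S> \<Longrightarrow> \<forall>\<beta>\<in>aboveS r (g S). \<beta> \<in> S"
    by metis
  have "|g ` \<S>| <o r"
    using card_of_image card assms(3) ordLeq_ordLess_trans ordLess_ordLeq_trans by blast
  then have "\<not> cofinal (g ` \<S>) r"
    using assms(2) g(1) not_ordLess_ordIso unfolding regularCard_def by blast
  \<comment> \<open>Failure of cofinality only gives \<open>g S\<close> weakly below
    \<open>a\<close>, which suffices because tails are strict.\<close>
  then obtain a where a: "a \<in> Field r" "\<And>S. S \<in> \<S> \<Longrightarrow> \<not> a \<sqsubset>\<^sub>r g S"
    unfolding cofinal_def by auto
  have "\<beta> \<in> S" if "\<beta> \<in> aboveS r a" "S \<in> \<S>" for \<beta> S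
  proof -
    have "(g S, a) \<in> r" using linear[OF a(1) g(1)] a(2) that by blast
    then have "\<beta> \<in> aboveS r (g S)" using le_less_trans[of "g S" a \<beta>] that by (auto simp: aboveS_def)
    then show ?thesis using g(2) that by blast
  qed
  then show "eventually (\<lambda>x. x \<in> \<Inter>\<S>) (tail_filter r)"
    unfolding eventually_tail_filter[OF assms(4)] using a(1) by blast
qed

lemma tail_filter_proper:
  assumes "Field r \<noteq> {}"
  shows "tail_filter r \<noteq> bot" "tail_filter r \<le> principal (Field r)"
proof -
  show "tail_filter r \<noteq> bot"
    using no_max unfolding eventually_False[symmetric] eventually_tail_filter[OF assms] by blast
  show "tail_filter r \<le> principal (Field r)"
    unfolding le_principal eventually_tail_filter[OF assms]
    using assms by (auto simp: aboveS_def Field_def)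
qed

end

section \<open>Vanishing of the direct limit\<close>

text \<open>Pairwise intersections serve. One set may arise from several pairs, so
  \<open>\<rho>\<close> and \<open>\<sigma>\<close> are chosen independently of each other.\<close>

lemma common_refinement:
  assumes "open_cover X \<U>" "open_cover X \<V>"
  obtains \<W> \<rho> \<sigma> where "open_cover X \<W>" "refinement_map \<W> \<U> \<rho>" "refinement_map \<W> \<V> \<sigma>"
proof -
  define \<W> where "\<W> = (\<lambda>(U, V). U \<inter> V) ` (\<U> \<times> \<V>)"
  have "\<forall>W\<in>\<W>. \<exists>U. U \<in> \<U> \<and> W \<subseteq> U" "\<forall>W\<in>\<W>. \<exists>V. V \<in> \<V> \<and> W \<subseteq> V"
    unfolding \<W>_def by blast+
  then obtain \<rho> \<sigma> where "refinement_map \<W> \<U> \<rho>" "refinement_map \<W> \<V> \<sigma>"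
    unfolding refinement_map_def by metis
  moreover have "open_cover X \<W>"
    using assms unfolding open_cover_def \<W>_def by (auto simp: openin_Int) blast+
  ultimately show thesis using that by blast
qed

section \<open>Operations on sections and pullback along refinements\<close>

lemma locally_constant_sheaf_restrict0:
  assumes "f \<in> locally_constant_sheaf X U" "V \<subseteq> U" "openin X V"
  shows "restrict0 V f \<in> locally_constant_sheaf X V"
proof -
  have "\<exists>N. openin X N \<and> x \<in> N \<and> N \<subseteq> V \<and> (\<forall>y\<in>N. restrict0 V f y = restrict0 V f x)"
    if x: "x \<in> V" for x
  proof -
    obtain N where N: "openin X N" "x \<in> N" "\<forall>y\<in>N. f y = f x"
      using assms(1,2) x unfolding locally_constant_sheaf_def by blast
    have "restrict0 V f y = restrict0 V f x" if "y \<in> N \<inter> V" for y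
      using bspec[OF N(3), of y] that x by (simp add: restrict0_def)
    moreover have "openin X (N \<inter> V)" using N(1) assms(3) by (rule openin_Int)
    ultimately show ?thesis using N(2) x by blast
  qed
  moreover have "restrict0 V f x = 0" if "x \<notin> V" for x using that by (simp add: restrict0_def)
  ultimately show ?thesis unfolding locally_constant_sheaf_def by blast
qed

lemma locally_constant_sheaf_diff:
  assumes "f \<in> locally_constant_sheaf X U" "g \<in> locally_constant_sheaf X U"
  shows "(\<lambda>x. f x - g x :: 'a::ab_group_add) \<in> locally_constant_sheaf X U"
proof -
  have "\<exists>N. openin X N \<and> x \<in> N \<and> N \<subseteq> U \<and> (\<forall>y\<in>N. f y - g y = f x - g x)"
    if x: "x \<in> U" for x
  proof -
    obtain N where N: "openin X N" "x \<in> N" "N \<subseteq> U" "\<forall>y\<in>N. f y = f x"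
      using assms(1) x unfolding locally_constant_sheaf_def by blast
    obtain M where M: "openin X M" "x \<in> M" "\<forall>y\<in>M. g y = g x"
      using assms(2) x unfolding locally_constant_sheaf_def by blast
    have "f y - g y = f x - g x" if "y \<in> N \<inter> M" for y
      using bspec[OF N(4), of y] bspec[OF M(3), of y] that by simp
    moreover have "openin X (N \<inter> M)" using N(1) M(1) by (rule openin_Int)
    ultimately show ?thesis using N(2,3) M(2) by blast
  qed
  moreover have "f x - g x = 0" if "x \<notin> U" for x
    using assms that by (simp add: locally_constant_sheaf_def)
  ultimately show ?thesis unfolding locally_constant_sheaf_def by blast
qed

lemma map_cover_tuples:
  "refinement_map \<W> \<U> \<rho> \<Longrightarrow> s \<in> cover_tuples n \<W> \<Longrightarrow> map \<rho> s \<in> cover_tuples n \<U>"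
  by (auto simp: refinement_map_def cover_tuples_def)

lemma Inter_map_refinement:
  assumes "refinement_map \<W> \<U> \<rho>" "s \<in> cover_tuples n \<W>"
  shows "\<Inter>(set s) \<subseteq> \<Inter>(set (map \<rho> s))"
  using assms by (auto simp: refinement_map_def cover_tuples_def)

text \<open>Applying \<open>\<rho>\<close> entrywise commutes with deleting an entry, so pullback
  commutes with the differential on the intersection of the refined tuple. Elsewhere the
  differential is \<open>0\<close> by convention.\<close>

lemma cech_pullback_cocycle:
  assumes c: "c \<in> cech_cocycles (locally_constant_sheaf X :: 'x set \<Rightarrow> ('x \<Rightarrow> 'a::ab_group_add) set) n \<U>"
    and \<W>: "open_cover X \<W>" and \<rho>: "refinement_map \<W> \<U> \<rho>"
  shows "cech_pullback n \<W> \<rho> c \<in> cech_cocycles (locally_constant_sheaf X) n \<W>"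
proof -
  have "cech_pullback n \<W> \<rho> c s \<in> locally_constant_sheaf X (\<Inter>(set s))" if s: "s \<in> cover_tuples n \<W>" for s
  proof -
    have "c (map \<rho> s) \<in> locally_constant_sheaf X (\<Inter>(set (map \<rho> s)))"
      using c map_cover_tuples[OF \<rho> s] unfolding cech_cocycles_def cech_cochains_def by blast
    then have "restrict0 (\<Inter>(set s)) (c (map \<rho> s)) \<in> locally_constant_sheaf X (\<Inter>(set s))"
      using Inter_map_refinement[OF \<rho> s] openin_Inter_tuple[OF \<W> s]
      by (rule locally_constant_sheaf_restrict0)
    then show ?thesis using s by (simp add: cech_pullback_def)
  qed
  then have "cech_pullback n \<W> \<rho> c \<in> cech_cochains (locally_constant_sheaf X) n \<W>"
    by (simp add: cech_cochains_def cech_pullback_def)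
  moreover have "cech_diff n \<W> (cech_pullback n \<W> \<rho> c) s x = 0" for s x
  proof (cases "s \<in> cover_tuples (Suc n) \<W> \<and> x \<in> \<Inter>(set s)")
    case True
    then have s: "s \<in> cover_tuples (Suc n) \<W>" and x: "x \<in> \<Inter>(set s)" by blast+
    have x': "x \<in> \<Inter>(set (map \<rho> s))" using Inter_map_refinement[OF \<rho> s] x by blast
    have "cech_diff n \<W> (cech_pullback n \<W> \<rho> c) s x = cech_diff n \<U> c (map \<rho> s) x"
    proof -
      have pull: "cech_pullback n \<W> \<rho> c (delete_at i s) x = c (delete_at i (map \<rho> s)) x" if "i \<le> Suc n" for i
        using delete_at_cover_tuples[OF s that] Inter_delete_at[OF x, of i]
        by (simp add: cech_pullback_def restrict0_def map_delete_at)
      have "(\<Sum>i\<le>Suc n. if even i then cech_pullback n \<W> \<rho> c (delete_at i s) x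
            else - cech_pullback n \<W> \<rho> c (delete_at i s) x)
          = (\<Sum>i\<le>Suc n. if even i then c (delete_at i (map \<rho> s)) x else - c (delete_at i (map \<rho> s)) x)"
        by (rule sum.cong) (simp_all add: pull)
      then show ?thesis
        using s x x' map_cover_tuples[OF \<rho> s]
        by (simp add: cech_diff_def restrict0_def del: sum.atMost_Suc set_map)
    qed
    then show ?thesis using c by (simp add: cech_cocycles_def)
  qed (auto simp: cech_diff_def restrict0_def)
  ultimately show ?thesis by (auto simp: cech_cocycles_def)
qed

lemma cech_cocycles_diff:
  assumes "c \<in> cech_cocycles (locally_constant_sheaf X :: 'x set \<Rightarrow> ('x \<Rightarrow> 'a::ab_group_add) set) n \<U>"
    "d \<in> cech_cocycles (locally_constant_sheaf X) n \<U>"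
  shows "(\<lambda>s x. c s x - d s x) \<in> cech_cocycles (locally_constant_sheaf X) n \<U>"
proof -
  have "cech_diff n \<U> (\<lambda>s x. c s x - d s x) s x = cech_diff n \<U> c s x - cech_diff n \<U> d s x" for s x
    unfolding cech_diff_def restrict0_def
    by (auto simp: sum_subtractf[symmetric] simp del: sum.atMost_Suc intro!: sum.cong)
  then show ?thesis
    using assms by (auto simp: cech_cocycles_def cech_cochains_def intro: locally_constant_sheaf_diff)
qed

lemma zero_cech_cocycle:
  assumes "open_cover X \<U>"
  shows "(\<lambda>s x. 0) \<in> cech_cocycles (locally_constant_sheaf X :: 'x set \<Rightarrow> ('x \<Rightarrow> 'a::ab_group_add) set) n \<U>"
proof -
  have "(\<lambda>x. 0) \<in> locally_constant_sheaf X U" if "openin X U" for U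
    using that by (auto simp: locally_constant_sheaf_def)
  then have "(\<lambda>s x. 0) \<in> cech_cochains (locally_constant_sheaf X) n \<U>"
    using openin_Inter_tuple[OF assms] by (auto simp: cech_cochains_def)
  moreover have "cech_diff n \<U> (\<lambda>s x. 0) = (\<lambda>s x. 0)"
    unfolding cech_diff_def restrict0_def by (intro ext) (simp cong: if_cong del: sum.atMost_Suc)
  ultimately show ?thesis by (simp add: cech_cocycles_def)
qed

text \<open>Pulled back to a common refinement, any two representatives differ by a cocycle, hence
  by a coboundary. All representatives are therefore equivalent and form a single class.\<close>

lemma trivial_cech_cohomology:
  fixes X :: "'x topology"
  assumes all: "\<And>\<U> c. open_cover X \<U> \<Longrightarrow>
    c \<in> cech_cocycles (locally_constant_sheaf X :: 'x set \<Rightarrow> ('x \<Rightarrow> 'a::ab_group_add) set) n \<U> \<Longrightarrow>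
    c \<in> cech_coboundaries (locally_constant_sheaf X) n \<U>"
  shows "trivial_group (cech_cohomology X (locally_constant_sheaf X :: 'x set \<Rightarrow> ('x \<Rightarrow> 'a) set) n)"
proof -
  let ?F = "locally_constant_sheaf X :: 'x set \<Rightarrow> ('x \<Rightarrow> 'a) set"
  let ?R = "cech_reps X ?F n" and ?E = "cech_equiv X ?F n"
  have "p \<in> ?R \<times> ?R \<longrightarrow> p \<in> ?E" for p
  proof
    assume "p \<in> ?R \<times> ?R"
    then obtain \<U> c \<V> d where p: "p = ((\<U>, c), (\<V>, d))" and reps: "(\<U>, c) \<in> ?R" "(\<V>, d) \<in> ?R"
      by auto
    then have U: "open_cover X \<U>" "c \<in> cech_cocycles ?F n \<U>" and V: "open_cover X \<V>" "d \<in> cech_cocycles ?F n \<V>"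
      by (auto simp: cech_reps_def)
    obtain \<W> \<rho> \<sigma> where W: "open_cover X \<W>" "refinement_map \<W> \<U> \<rho>" "refinement_map \<W> \<V> \<sigma>"
      using common_refinement[OF U(1) V(1)] .
    have "(\<lambda>s x. cech_pullback n \<W> \<rho> c s x - cech_pullback n \<W> \<sigma> d s x) \<in> cech_coboundaries ?F n \<W>"
      by (rule all[OF W(1) cech_cocycles_diff[OF cech_pullback_cocycle[OF U(2) W(1,2)]
        cech_pullback_cocycle[OF V(2) W(1,3)]]])
    then show "p \<in> ?E" unfolding p cech_equiv_def using reps W by blast
  qed
  moreover have "?E \<subseteq> ?R \<times> ?R" by (auto simp: cech_equiv_def)
  ultimately have E: "?E = ?R \<times> ?R" by blast
  have top: "open_cover X {topspace X}" by (simp add: open_cover_def)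
  \<comment> \<open>A representative exists, so the quotient has one class and is not empty.\<close>
  have zero: "({topspace X}, \<lambda>s x. 0) \<in> ?R"
    using zero_cech_cocycle[OF top] top by (simp add: cech_reps_def)
  have carrier: "carrier (cech_cohomology X ?F n) = {?R}"
    using zero unfolding cech_cohomology_def E quotient_def by auto
  have one: "one (cech_cohomology X ?F n) = ?R"
    using zero unfolding cech_cohomology_def E by auto
  have mult: "mult (cech_cohomology X ?F n) ?R ?R = ?R"
  proof -
    have id: "refinement_map {topspace X} {topspace X} id" by (simp add: refinement_map_def)
    have "cech_pullback n {topspace X} id (\<lambda>s x. 0 :: 'a) = (\<lambda>s x. 0)"
      by (auto simp: cech_pullback_def restrict0_def)
    then have mem: "({topspace X}, \<lambda>s x. 0 :: 'a) \<in>
      {(\<W>, \<lambda>s x. cech_pullback n \<W> \<rho> c s x + cech_pullback n \<W> \<sigma> d s x) | \<W> \<rho> \<sigma> \<U> c \<V> d.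
        (\<U>, c) \<in> ?R \<and> (\<V>, d) \<in> ?R \<and> open_cover X \<W> \<and> refinement_map \<W> \<U> \<rho> \<and> refinement_map \<W> \<V> \<sigma>}"
      using zero top id by (intro CollectI exI[of _ "{topspace X}"] exI[of _ id] exI[of _ "\<lambda>s x. 0 :: 'a"]) simp
    \<comment> \<open>Saturating any set that contains a representative gives all of
      \<open>?R\<close>, so one sum, here that of two zero cocycles, determines the product.\<close>
    have "(?R \<times> ?R) `` S = ?R" if "z \<in> S" "z \<in> ?R" for S z
      using that by blast
    from this[OF mem zero] show ?thesis
      unfolding cech_cohomology_def E monoid.select_convs .
  qed
  have "group (cech_cohomology X ?F n)"
    by (rule groupI) (simp_all add: one carrier mult)
  then show ?thesis using one carrier by (simp add: trivial_group_def)
qed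

theorem theorem3p9:
  fixes \<mu> \<kappa> lam :: "'u rel" and n :: nat
  assumes "Card_order \<mu>" and "natLeq <o \<mu>"
    and "Card_order \<kappa>" and "natLeq <o \<kappa>"
    and "\<mu> \<le>o \<kappa>"
    and "|UNIV :: 'a::ab_group_add set| <o \<mu>"
    and "strongly_compact \<mu> \<kappa>"
    and "Card_order lam" and "regularCard lam" and "\<kappa> \<le>o lam"
    and "n \<ge> 1"
  shows "trivial_group (cech_cohomology (order_topology_of lam)
    (locally_constant_sheaf (order_topology_of lam) :: 'u set \<Rightarrow> ('u \<Rightarrow> 'a) set) n)"
proof -
  have "natLeq \<le>o lam" by (rule ordLess_imp_ordLeq[OF ordLess_ordLeq_trans[OF assms(4,10)]])
  then have infinite: "infinite (Field lam)"
    using infinite_iff_natLeq_ordLeq[of "Field lam"]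
      ordLeq_ordIso_trans[OF _ ordIso_symmetric[OF card_of_Field_ordIso[OF assms(8)]]] by blast
  interpret limit_order lam
  proof
    show "Well_order lam" using assms(8) by (rule Card_order_wo_rel[unfolded wo_rel_def])
    show "aboveS lam x \<noteq> {}" if "x \<in> Field lam" for x
      using infinite_Card_order_limit[OF assms(8) infinite that] by (auto simp: aboveS_def)
  qed
  have ne: "Field lam \<noteq> {}" using infinite by auto
  \<comment> \<open>Strong compactness is applied once, to the tail filter on
    \<open>Field lam\<close>; the resulting \<open>G\<close> serves all covers and cocycles.\<close>
  obtain G where G: "G \<le> tail_filter lam" "ultrafilter_on (Field lam) G" "complete_filter \<mu> G"
    using assms(7) tail_filter_proper[OF ne] tail_filter_complete[OF assms(8-10) ne]
    unfolding strongly_compact_def by blast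
  \<comment> \<open>Uncountability of \<open>\<mu>\<close> turns \<open>\<mu>\<close>-completeness
    into countable completeness.\<close>
  have nat: "|UNIV :: nat set| <o \<mu>" using card_of_nat assms(2) by (rule ordIso_ordLess_trans)
  obtain m where n: "n = Suc m" using assms(11) by (cases n) auto
  have tails: "eventually (\<lambda>\<beta>. (y, \<beta>) \<in> lam \<and> y \<noteq> \<beta>) G" if "y \<in> Field lam" for y
  proof (rule filter_leD[OF G(1)])
    show "eventually (\<lambda>\<beta>. (y, \<beta>) \<in> lam \<and> y \<noteq> \<beta>) (tail_filter lam)"
      unfolding eventually_tail_filter[OF ne] using that by (auto simp: aboveS_def)
  qed
  have proper: "G \<noteq> bot" using G(2) by (simp add: ultrafilter_on_def)
  show ?thesis
    unfolding n
  proof (rule trivial_cech_cohomology)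
    fix \<U> and c :: "'u set list \<Rightarrow> 'u \<Rightarrow> 'a"
    assume "open_cover (order_topology_of lam) \<U>" "c \<in> cech_cocycles (locally_constant_sheaf (order_topology_of lam)) (Suc m) \<U>"
    then show "c \<in> cech_coboundaries (locally_constant_sheaf (order_topology_of lam)) (Suc m) \<U>"
      using tails proper
    proof (rule cocycle_is_coboundary)
      show "eventually (\<lambda>\<beta>. \<forall>k. P k \<beta>) G" if "\<And>k::nat. eventually (P k) G" for P
        using that by (rule complete_filter_all[OF G(3) nat])
      show "\<exists>a. eventually (\<lambda>\<beta>. f \<beta> = a) G" for f :: "'u \<Rightarrow> 'a"
        by (rule complete_ultrafilter_limit[OF G(2,3) assms(6)])
    qed
  qed
qed

end
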